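(* Let $G$ be a connected graph with boundary, having $k\ge 2$ interior vertices and interior diameter $d_\Omega$. Then $$\lambda_2(G)\ \geq\ \frac{k}{(k-1)^2\, d_\Omega}.$$ Moreover, this bound is sharp up to a constant factor: there is an absolute constant $C>0$ such that for every $N\in\mathbb{N}$ there exists a connected graph with boundary $G$ with $k\ge N$ interior vertices and interior diameter $d_\Omega\ge N$ satisfying $\lambda_2(G)\le C\,\dfrac{k}{(k-1)^2\,d_\Omega}$.
   Context: All graphs are finite, simple and undirected, $G=(V,E)$, and $x\sim y$ means $x,y$ are adjacent. For $S\subset V$, $\delta S=\{i\in V\setminus S: i\sim j\text{ for some }j\in S\}$. A graph with boundary is a pair $(G,B)$ with $B\subset V$, $\delta(V\setminus B)=B$, and no edge of $G$ joining two vertices of $B$. The set $B$ is the boundary, $\Omega_G=V\setminus B$ is the interior (so $B=\delta\Omega_G$), and $k=|\Omega_G|$. The interior diameter $d_\Omega$ is $\max_{x,y\in\Omega_G} d(x,y)$, where $d$ is the graph distance in $G$. For $f\in\mathbb{R}^V$ put $(\Delta f)(x)=\sum_{y\sim x}(f(x)-f(y))$ for $x\in V$, and $\frac{\partial f}{\partial\nu}(x)=\sum_{y\in\Omega_G,\,y\sim x}(f(x)-f(y))$ for $x\in\delta\Omega_G$. The Neumann eigenvalue problem asks for nonzero $f\in\mathbb{R}^V$ and $\lambda\in\mathbb{R}$ with $\Delta f=\lambda f$ on $\Omega_G$ and $\frac{\partial f}{\partial \nu}=0$ on $\delta\Omega_G$. Equivalently, the Neumann eigenvalues are the eigenvalues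 of $\Delta^N:\mathbb{R}^{\Omega_G}\to\mathbb{R}^{\Omega_G}$, $\Delta^N f=\Delta(\Lambda f)|_{\Omega_G}$, where $\Lambda f=f$ on $\Omega_G$ and $(\Lambda f)(x)=\frac{1}{\deg(x)}\sum_{y\sim x}f(y)$ for $x\in\delta\Omega_G$. The operator $\Delta^N$ is self-adjoint and non-negative, and for connected $G$ its eigenvalues, counted with multiplicity, are listed as $0=\lambda_1(G)<\lambda_2(G)\le\cdots\le\lambda_k(G)$. *)

theory Defs
  imports "Graph_Theory.Graph_Theory" "HOL-Library.Function_Algebras"
begin

text \<open>
  Finite simple undirected graphs are \<^locale>\<open>pair_graph\<close>s: the arc relation
  \<^term>\<open>parcs G\<close> is finite, irreflexive, symmetric and contained in
  \<^term>\<open>pverts G \<times> pverts G\<close>, and \<open>(x, y) \<in> parcs G\<close> is the adjacency \<open>x \<sim> y\<close>.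
\<close>

definition vertex_boundary :: "'a pair_pre_digraph \<Rightarrow> 'a set \<Rightarrow> 'a set" where
  "vertex_boundary G S = {i \<in> pverts G - S. \<exists>j\<in>S. (i, j) \<in> parcs G}"

definition interior_verts :: "'a pair_pre_digraph \<Rightarrow> 'a set \<Rightarrow> 'a set" where
  "interior_verts G B = pverts G - B"

locale graph_with_boundary = pair_graph G
  for G :: "'a pair_pre_digraph" and B :: "'a set" +
  assumes boundary_subset: "B \<subseteq> pverts G"
    and boundary_eq: "vertex_boundary G (interior_verts G B) = B"
    and no_boundary_arcs: "\<And>x y. x \<in> B \<Longrightarrow> y \<in> B \<Longrightarrow> (x, y) \<notin> parcs G"

definition graph_dist :: "'a pair_pre_digraph \<Rightarrow> 'a \<Rightarrow> 'a \<Rightarrow> nat" where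
  "graph_dist G x y = (LEAST n. \<exists>p. pre_digraph.awalk (with_proj G) x p y \<and> length p = n)"

definition interior_diameter :: "'a pair_pre_digraph \<Rightarrow> 'a set \<Rightarrow> nat" where
  "interior_diameter G B =
     Max ((\<lambda>(x, y). graph_dist G x y) ` (interior_verts G B \<times> interior_verts G B))"

definition laplacian :: "'a pair_pre_digraph \<Rightarrow> ('a \<Rightarrow> real) \<Rightarrow> 'a \<Rightarrow> real" where
  "laplacian G f x = (\<Sum>y | (x, y) \<in> parcs G. f x - f y)"

text \<open>
  Function spaces over a vertex set are represented by functions on the whole type that
  vanish outside that set, so that they are subspaces of the real vector space
  \<^typ>\<open>'a \<Rightarrow> real\<close>.
\<close>

interpretation real_fun: vector_space "\<lambda>(c::real) (f::'a \<Rightarrow> real) x. c * f x"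
  by unfold_locales (auto simp: fun_eq_iff algebra_simps)

definition neumann_extension ::
    "'a pair_pre_digraph \<Rightarrow> 'a set \<Rightarrow> ('a \<Rightarrow> real) \<Rightarrow> 'a \<Rightarrow> real" where
  "neumann_extension G B f x =
     (if x \<in> interior_verts G B then f x
      else if x \<in> B then (1 / real (out_degree (with_proj G) x)) * (\<Sum>y | (x, y) \<in> parcs G. f y)
      else 0)"

definition neumann_laplacian ::
    "'a pair_pre_digraph \<Rightarrow> 'a set \<Rightarrow> ('a \<Rightarrow> real) \<Rightarrow> 'a \<Rightarrow> real" where
  "neumann_laplacian G B f x =
     (if x \<in> interior_verts G B then laplacian G (neumann_extension G B f) x else 0)"

definition neumann_eigenspace :: "'a pair_pre_digraph \<Rightarrow> 'a set \<Rightarrow> real \<Rightarrow> ('a \<Rightarrow> real) set" where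
  "neumann_eigenspace G B l =
     {f. (\<forall>x. x \<notin> interior_verts G B \<longrightarrow> f x = 0) \<and>
         neumann_laplacian G B f = (\<lambda>x. l * f x)}"

text \<open>
  The eigenvalues in increasing order, each repeated according to its multiplicity. The
  operator is self-adjoint, so the multiplicity is the dimension of the eigenspace; numbers
  that are not eigenvalues have the eigenspace \<open>{0}\<close> and occur zero times.
\<close>

definition neumann_eigenvalues :: "'a pair_pre_digraph \<Rightarrow> 'a set \<Rightarrow> real list" where
  "neumann_eigenvalues G B =
     (THE ls. sorted ls \<and> (\<forall>l. count_list ls l = real_fun.dim (neumann_eigenspace G B l)))"

text \<open>The index of the eigenvalues starts at 1, while list positions start at 0.\<close>

definition neumann_eigenvalue :: "'a pair_pre_digraph \<Rightarrow> 'a set \<Rightarrow> nat \<Rightarrow> real" where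
  "neumann_eigenvalue G B j = neumann_eigenvalues G B ! (j - 1)"

text \<open>The qualification avoids the topological notion of the same name.\<close>

abbreviation graph_connected :: "'a pair_pre_digraph \<Rightarrow> bool" where
  "graph_connected G \<equiv> Digraph_Component.connected (with_proj G)"

end

theory Submission
  imports Defs "HOL-Analysis.Function_Topology" "HOL-Analysis.Convex" "HOL-Library.Multiset"
begin

text \<open>
  Write \<open>\<Omega>\<close> for the interior, \<open>k\<close> for its size and \<open>d\<close> for the interior diameter. The Neumann
  Laplacian \<open>L\<close> is the operator of the Dirichlet form: extending a function to the boundary by
  averaging makes it harmonic there, so summation by parts over all vertices gives
  \<open>\<Sum>\<^sub>\<Omega> (L f) h = 1/2 \<Sum> (F x - F y) (H x - H y)\<close>, the sum running over all arcs and \<open>F\<close>, \<open>H\<close> being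
  the extensions (\<open>green_formula\<close>). Hence \<open>L\<close> is symmetric and non-negative.

  The lower bound is a Poincare inequality for functions \<open>f\<close> with \<open>\<Sum>\<^sub>\<Omega> f = 0\<close>
  (\<open>poincare_inequality\<close>). Let \<open>\<bar>f x\<bar>\<close> be maximal. The other \<open>k - 1\<close> values sum to \<open>- f x\<close>, so some
  \<open>f y\<close> lies on the opposite side of zero with \<open>\<bar>f x - f y\<bar> \<ge> \<bar>f x\<bar> k / (k - 1)\<close>. A shortest walk from
  \<open>x\<close> to \<open>y\<close> uses at most \<open>d\<close> edges, each once, so Cauchy-Schwarz bounds \<open>(f x - f y)\<^sup>2\<close> by \<open>d\<close> times
  the Dirichlet energy; and \<open>\<Sum>\<^sub>\<Omega> f\<^sup>2 \<le> k (f x)\<^sup>2\<close>. The constant obtained is \<open>k / ((k - 1)\<^sup>2 d)\<close>.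

  To transfer this to the second entry of the ordered list of eigenvalues, the spectrum has to be
  understood to the following extent. The list exists, since eigenfunctions of distinct
  eigenvalues are orthogonal and the functions on \<open>\<Omega>\<close> form a finite-dimensional space. By
  the Poincare inequality the kernel of \<open>L\<close> consists of the constants, so the list starts with
  exactly one \<open>0\<close>. A minimiser of the Rayleigh quotient among the functions of sum zero exists by
  compactness and is an eigenfunction; it shows that the list has a second entry, and that this
  entry is at most the Rayleigh quotient of every function of sum zero (\<open>second_eigenvalue\<close>).

  For the sharpness take the path on \<open>k\<close> vertices with empty boundary, whose interior diameter is
  \<open>k - 1\<close>. The linear function centred at zero has energy \<open>k - 1\<close> and square sum
  \<open>k (k - 1) (k + 1) / 12\<close>, so the second eigenvalue is at most \<open>12 / (k (k + 1))\<close>, which is of the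
  same order \<open>1 / k\<^sup>2\<close> as the lower bound.
\<close>

section \<open>Sorted lists with prescribed multiplicities\<close>

text \<open>
  The ordered list of eigenvalues is introduced by a definite description over lists with
  prescribed multiplicities. Such a list exists and is unique as soon as only finitely many values
  have to occur, because a sorted list is determined by its multiset of entries.
\<close>

lemma ex1_sorted_count_list:
  fixes c :: "'b::linorder \<Rightarrow> nat"
  assumes "finite {l. c l \<noteq> 0}"
  shows "\<exists>!ls. sorted ls \<and> (\<forall>l. count_list ls l = c l)"
proof (rule ex1I)
  let ?ls = "sorted_list_of_multiset (Abs_multiset c)"
  have "count (Abs_multiset c) = c"
    using assms by (intro count_Abs_multiset) simp
  note [simp] = this
  show ex: "sorted ?ls \<and> (\<forall>l. count_list ?ls l = c l)"
    by (simp flip: count_mset)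
  fix ls assume ls: "sorted ls \<and> (\<forall>l. count_list ls l = c l)"
  then have "mset ls = mset ?ls"
    using ex by (intro multiset_eqI) (simp add: count_mset)
  then show "ls = ?ls"
    using ls ex by (metis properties_for_sort sorted_sort_id)
qed

section \<open>Distances and walks\<close>

context pair_graph
begin

text \<open>
  Relation powers provide a walk as a function from positions to vertices, which is the form in
  which telescoping sums along it can be written.
\<close>

lemma awalk_length_iff_relpow:
  "(\<exists>p. awalk x p y \<and> length p = n) \<longleftrightarrow> x \<in> pverts G \<and> (x, y) \<in> parcs G ^^ n"
proof (induction n arbitrary: x)
  case 0
  then show ?case by (auto simp: awalk_Nil_iff)
next
  case (Suc n)
  have "(\<exists>p. awalk x p y \<and> length p = Suc n) \<longleftrightarrow>
      (\<exists>z. (x, z) \<in> parcs G \<and> (\<exists>p. awalk z p y \<and> length p = n))"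
  proof (intro iffI; elim exE conjE)
    fix p assume "awalk x p y" "length p = Suc n"
    then obtain z q where "p = (x, z) # q" "awalk x ((x, z) # q) y" "length q = n"
      by (cases p) (auto simp: awalk_Cons_iff)
    then show "\<exists>z. (x, z) \<in> parcs G \<and> (\<exists>p. awalk z p y \<and> length p = n)"
      by (auto simp: awalk_Cons_iff)
  next
    fix z p assume "(x, z) \<in> parcs G" "awalk z p y" "length p = n"
    then show "\<exists>p. awalk x p y \<and> length p = Suc n"
      by (intro exI[of _ "(x, z) # p"]) (simp add: awalk_Cons_iff)
  qed
  also have "\<dots> \<longleftrightarrow> (\<exists>z. (x, z) \<in> parcs G \<and> (z, y) \<in> parcs G ^^ n)"
    unfolding Suc.IH using in_arcsD2 by blast
  also have "\<dots> \<longleftrightarrow> x \<in> pverts G \<and> (x, y) \<in> parcs G ^^ Suc n"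
    using in_arcsD1 by (blast intro: relpow_Suc_I2 elim: relpow_Suc_E2)
  finally show ?case .
qed

lemma graph_dist_le:
  assumes "x \<in> pverts G" "(x, y) \<in> parcs G ^^ n"
  shows "graph_dist G x y \<le> n"
  unfolding graph_dist_def using assms awalk_length_iff_relpow by (intro Least_le) blast

lemma relpow_graph_dist:
  assumes "x \<in> pverts G" "(x, y) \<in> parcs G ^^ n"
  shows "(x, y) \<in> parcs G ^^ graph_dist G x y"
proof -
  have "\<exists>p. awalk x p y \<and> length p = graph_dist G x y"
    unfolding graph_dist_def by (rule LeastI_ex) (use assms awalk_length_iff_relpow in blast)
  then show ?thesis using awalk_length_iff_relpow by blast
qed

lemma connected_iff_relpow:
  "graph_connected G \<longleftrightarrow>
     pverts G \<noteq> {} \<and> (\<forall>x\<in>pverts G. \<forall>y\<in>pverts G. \<exists>n. (x, y) \<in> parcs G ^^ n)"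
proof -
  have "graph_connected G \<longleftrightarrow>
      pverts G \<noteq> {} \<and> (\<forall>x\<in>pverts G. \<forall>y\<in>pverts G. \<exists>p. awalk x p y)"
    by (simp add: Digraph_Component.connected_def strongly_connected_def
        reachable_mk_symmetric_eq[OF sym_arcs] reachable_awalk)
  then show ?thesis using awalk_length_iff_relpow by blast
qed

text \<open>
  A shortest walk repeats no vertex, since a repetition could be cut out. Hence the walk and its
  reversal use each arc at most once, and Cauchy-Schwarz along the walk applies.
\<close>

lemma square_diff_le_dist_energy:
  fixes F :: "'a \<Rightarrow> real"
  assumes x: "x \<in> pverts G" and xy: "(x, y) \<in> parcs G ^^ n"
  shows "(F x - F y)\<^sup>2 \<le> real (graph_dist G x y) * ((\<Sum>(u, v)\<in>parcs G. (F u - F v)\<^sup>2) / 2)"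
proof -
  define m where "m = graph_dist G x y"
  obtain w where w: "w 0 = x" "w m = y" "\<And>i. i < m \<Longrightarrow> (w i, w (Suc i)) \<in> parcs G"
    using relpow_graph_dist[OF x xy] unfolding m_def relpow_fun_conv by blast
  have seg: "(w i, w j) \<in> parcs G ^^ (j - i)" if "i \<le> j" "j \<le> m" for i j
    unfolding relpow_fun_conv using that w(3)
    by (intro exI[of _ "\<lambda>l. w (i + l)"]) auto
  have neq: "w i \<noteq> w j" if "i < j" "j \<le> m" for i j
  proof
    assume "w i = w j"
    then have "(x, w j) \<in> parcs G ^^ i" "(w j, y) \<in> parcs G ^^ (m - j)"
      using seg[of 0 i] seg[of j m] that w by auto
    then have "(x, y) \<in> parcs G ^^ (i + (m - j))" by (auto simp: relpow_add)
    from graph_dist_le[OF x this] show False using that by (simp flip: m_def)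
  qed
  have inj: "w i = w j \<longleftrightarrow> i = j" if "i \<le> m" "j \<le> m" for i j
    using neq[of i j] neq[of j i] that by (metis linorder_neqE_nat)
  define A where "A = (\<lambda>i. (w i, w (Suc i))) ` {..<m}"
  define A' where "A' = (\<lambda>i. (w (Suc i), w i)) ` {..<m}"
  have fin: "finite A" "finite A'" by (simp_all add: A_def A'_def)
  have disj: "A \<inter> A' = {}" by (auto simp: A_def A'_def inj)
  have sub: "A \<union> A' \<subseteq> parcs G"
    using w(3) arcs_symmetric by (auto simp: A_def A'_def)
  let ?q = "\<lambda>(u, v). (F u - F v)\<^sup>2"
  have A: "sum ?q A = (\<Sum>i<m. (F (w (Suc i)) - F (w i))\<^sup>2)"
    unfolding A_def by (subst sum.reindex) (auto simp: inj_on_def inj power2_commute)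
  have A': "sum ?q A' = (\<Sum>i<m. (F (w (Suc i)) - F (w i))\<^sup>2)"
    unfolding A'_def by (subst sum.reindex) (auto simp: inj_on_def inj)
  have "(F x - F y)\<^sup>2 = (\<Sum>i<m. F (w (Suc i)) - F (w i))\<^sup>2"
    by (simp add: sum_lessThan_telescope[of "\<lambda>i. F (w i)"] w power2_commute)
  also have "\<dots> \<le> real m * (\<Sum>i<m. (F (w (Suc i)) - F (w i))\<^sup>2)"
    using sum_squared_le_sum_of_squares[of "\<lambda>i. F (w (Suc i)) - F (w i)" "{..<m}"]
    by (simp add: mult.commute)
  also have "(\<Sum>i<m. (F (w (Suc i)) - F (w i))\<^sup>2) = sum ?q (A \<union> A') / 2"
    by (simp add: sum.union_disjoint[OF fin disj] A A')
  also have "sum ?q (A \<union> A') \<le> sum ?q (parcs G)"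
    using pair_finite_arcs sub by (intro sum_mono2) auto
  finally show ?thesis by (simp add: m_def mult_left_mono)
qed

end

section \<open>The Dirichlet form of the Neumann Laplacian\<close>

context graph_with_boundary
begin

abbreviation \<Omega> where "\<Omega> \<equiv> interior_verts G B"

abbreviation ext :: "('a \<Rightarrow> real) \<Rightarrow> 'a \<Rightarrow> real" where "ext \<equiv> neumann_extension G B"

abbreviation L :: "('a \<Rightarrow> real) \<Rightarrow> 'a \<Rightarrow> real" where "L \<equiv> neumann_laplacian G B"

definition dirichlet_form :: "('a \<Rightarrow> real) \<Rightarrow> ('a \<Rightarrow> real) \<Rightarrow> real" where
  "dirichlet_form f h = (\<Sum>(x, y)\<in>parcs G. (ext f x - ext f y) * (ext h x - ext h y)) / 2"

lemma finite_interior [simp]: "finite \<Omega>"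
  using pair_finite_verts by (simp add: interior_verts_def)

lemma interior_in_verts: "x \<in> \<Omega> \<Longrightarrow> x \<in> pverts G"
  by (simp add: interior_verts_def)

lemma verts_partition: "pverts G = \<Omega> \<union> B" "\<Omega> \<inter> B = {}"
  using boundary_subset by (auto simp: interior_verts_def)

lemma finite_neighbours [simp]: "finite {y. (x, y) \<in> parcs G}"
  by (rule finite_subset[OF _ pair_finite_verts]) (auto dest: in_arcsD2)

lemma boundary_neighbours:
  assumes "x \<in> B"
  shows "{y. (x, y) \<in> parcs G} \<subseteq> \<Omega>" "{y. (x, y) \<in> parcs G} \<noteq> {}"
proof -
  show "{y. (x, y) \<in> parcs G} \<subseteq> \<Omega>"
    using assms no_boundary_arcs in_arcsD2 by (auto simp: interior_verts_def)
  have "x \<in> vertex_boundary G \<Omega>" using assms boundary_eq by simp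
  then show "{y. (x, y) \<in> parcs G} \<noteq> {}" by (auto simp: vertex_boundary_def)
qed

lemma ext_interior: "x \<in> \<Omega> \<Longrightarrow> ext f x = f x"
  by (simp add: neumann_extension_def)

lemma ext_linear: "ext (\<lambda>x. f x + c * h x) = (\<lambda>x. ext f x + c * ext h x)"
  by (rule ext) (simp add: neumann_extension_def sum.distrib sum_distrib_left algebra_simps)

lemma neumann_laplacian_linear: "L (\<lambda>x. f x + c * h x) = (\<lambda>x. L f x + c * L h x)"
  by (rule HOL.ext)
    (simp add: neumann_laplacian_def laplacian_def ext_linear sum_distrib_left
      flip: sum.distrib, simp add: algebra_simps)

lemma neumann_laplacian_outside: "x \<notin> \<Omega> \<Longrightarrow> L f x = 0"
  by (simp add: neumann_laplacian_def)

text \<open>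
  Averaging over the neighbours makes the extension harmonic at boundary vertices; all their
  neighbours are interior, so that the average only involves the given values.
\<close>

lemma laplacian_extension_boundary:
  assumes x: "x \<in> B"
  shows "laplacian G (ext f) x = 0"
proof -
  let ?N = "{y. (x, y) \<in> parcs G}"
  have "out_degree (with_proj G) x = card ?N"
  proof -
    have "out_arcs (with_proj G) x = Pair x ` ?N" by (auto simp: out_arcs_def)
    then show ?thesis by (simp add: out_degree_def card_image inj_on_def)
  qed
  moreover have "x \<notin> \<Omega>" using x verts_partition by auto
  ultimately have "real (card ?N) * ext f x = (\<Sum>y\<in>?N. f y)"
    using x boundary_neighbours(2)[OF x] by (simp add: neumann_extension_def)
  moreover have "(\<Sum>y\<in>?N. ext f y) = (\<Sum>y\<in>?N. f y)"
    using boundary_neighbours(1)[OF x] by (intro sum.cong) (auto simp: ext_interior)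
  ultimately show ?thesis by (simp add: laplacian_def sum_subtractf)
qed

text \<open>
  The boundary terms may be added because the extension is harmonic there; the rest is summation
  by parts over the whole graph.
\<close>

lemma green_formula: "(\<Sum>x\<in>\<Omega>. L f x * h x) = dirichlet_form f h"
proof -
  let ?F = "ext f" and ?H = "ext h"
  have "(\<Sum>x\<in>\<Omega>. L f x * h x) = (\<Sum>x\<in>\<Omega>. laplacian G ?F x * ?H x)"
    by (intro sum.cong) (auto simp: neumann_laplacian_def ext_interior)
  also have "\<dots> = (\<Sum>x\<in>pverts G. laplacian G ?F x * ?H x)"
    using pair_finite_verts verts_partition laplacian_extension_boundary
    by (intro sum.mono_neutral_left) auto
  also have "\<dots> = (\<Sum>x\<in>pverts G. \<Sum>y | (x, y) \<in> parcs G. (?F x - ?F y) * ?H x)"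
    by (simp add: laplacian_def sum_distrib_right)
  also have "\<dots> = (\<Sum>(x, y)\<in>parcs G. (?F x - ?F y) * ?H x)"
  proof -
    have "parcs G = (SIGMA x:pverts G. {y. (x, y) \<in> parcs G})" by (auto dest: in_arcsD1)
    then show ?thesis
      using pair_finite_verts by (subst sum.Sigma) auto
  qed
  finally have 1: "(\<Sum>x\<in>\<Omega>. L f x * h x) = (\<Sum>(x, y)\<in>parcs G. (?F x - ?F y) * ?H x)" .
  \<comment> \<open>Reversing all arcs gives a second expression for the same sum; the form is their average.\<close>
  have "(\<Sum>(x, y)\<in>parcs G. (?F x - ?F y) * ?H x) = (\<Sum>(x, y)\<in>parcs G. (?F y - ?F x) * ?H y)"
    by (rule sum.reindex_bij_witness[of _ prod.swap prod.swap]) (auto intro: arcs_symmetric)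
  then have "2 * (\<Sum>x\<in>\<Omega>. L f x * h x)
      = (\<Sum>(x, y)\<in>parcs G. (?F x - ?F y) * ?H x) + (\<Sum>(x, y)\<in>parcs G. (?F y - ?F x) * ?H y)"
    by (simp add: 1)
  also have "\<dots> = 2 * dirichlet_form f h"
    unfolding dirichlet_form_def by (simp flip: sum.distrib add: case_prod_unfold algebra_simps)
  finally show ?thesis by simp
qed

lemma dirichlet_form_commute: "dirichlet_form f h = dirichlet_form h f"
  by (simp add: dirichlet_form_def mult.commute)

lemma dirichlet_form_self:
  "dirichlet_form f f = (\<Sum>(x, y)\<in>parcs G. (ext f x - ext f y)\<^sup>2) / 2"
  by (simp add: dirichlet_form_def power2_eq_square)

lemma dirichlet_form_nonneg: "0 \<le> dirichlet_form f f"
  by (auto simp: dirichlet_form_self intro!: sum_nonneg)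

lemma dirichlet_form_linear_left:
  "dirichlet_form (\<lambda>x. f x + c * h x) g = dirichlet_form f g + c * dirichlet_form h g"
  by (simp flip: green_formula add: neumann_laplacian_linear algebra_simps
      sum.distrib sum_distrib_left)

text \<open>
  The expansion needed for the first variation of the Rayleigh quotient.
\<close>

lemma dirichlet_form_add_scaled:
  "dirichlet_form (\<lambda>x. f x + c * h x) (\<lambda>x. f x + c * h x)
    = dirichlet_form f f + 2 * c * dirichlet_form f h + c\<^sup>2 * dirichlet_form h h"
  by (simp add: dirichlet_form_linear_left
      dirichlet_form_commute[of _ "\<lambda>x. f x + c * h x"] dirichlet_form_commute[of h f]
      power2_eq_square algebra_simps)

lemma dirichlet_form_scaled:
  "dirichlet_form (\<lambda>x. c * h x) (\<lambda>x. c * h x) = c\<^sup>2 * dirichlet_form h h"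
proof -
  have "ext (\<lambda>x. c * h x) x = c * ext h x" for x
    by (simp add: neumann_extension_def sum_distrib_left)
  then show ?thesis
    by (simp add: dirichlet_form_self power_mult_distrib case_prod_unfold
        flip: right_diff_distrib sum_distrib_left)
qed

lemma neumann_laplacian_one: "L (indicator \<Omega>) = (\<lambda>x. 0)"
proof -
  let ?one = "indicator \<Omega> :: 'a \<Rightarrow> real"
  have "ext ?one x = 1" if "x \<in> pverts G" for x
  proof (cases "x \<in> \<Omega>")
    case False
    then have x: "x \<in> B" using that verts_partition by auto
    \<comment> \<open>A boundary value is determined by its vanishing Laplacian.\<close>
    let ?N = "{y. (x, y) \<in> parcs G}"
    have "(\<Sum>y\<in>?N. ext ?one x - ext ?one y) = (\<Sum>y\<in>?N. ext ?one x - 1)"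
      using boundary_neighbours(1)[OF x] by (intro sum.cong) (auto simp: ext_interior)
    then have "real (card ?N) * (ext ?one x - 1) = 0"
      using laplacian_extension_boundary[OF x, of ?one] by (simp add: laplacian_def)
    then show ?thesis using boundary_neighbours(2)[OF x] by auto
  qed (simp add: ext_interior)
  then have "laplacian G (ext ?one) x = 0" for x
    unfolding laplacian_def using in_arcsD1 in_arcsD2 by (intro sum.neutral) simp
  then show ?thesis by (simp add: neumann_laplacian_def fun_eq_iff)
qed

lemma sum_neumann_laplacian: "(\<Sum>x\<in>\<Omega>. L f x) = 0"
proof -
  have "(\<Sum>x\<in>\<Omega>. L f x) = dirichlet_form f (indicator \<Omega>)"
    by (simp flip: green_formula)
  also have "\<dots> = 0"
    unfolding dirichlet_form_commute[of f]
    by (simp flip: green_formula add: neumann_laplacian_one)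
  finally show ?thesis .
qed

section \<open>The Poincare inequality\<close>

text \<open>
  The orthogonal complement of the constants among the functions on the interior: the test
  functions for the second eigenvalue.
\<close>

definition mean_zero :: "('a \<Rightarrow> real) set" where
  "mean_zero = {f. (\<forall>x. x \<notin> \<Omega> \<longrightarrow> f x = 0) \<and> (\<Sum>x\<in>\<Omega>. f x) = 0}"

lemma mean_zero_linear:
  "f \<in> mean_zero \<Longrightarrow> h \<in> mean_zero \<Longrightarrow> (\<lambda>x. f x + c * h x) \<in> mean_zero"
  by (simp add: mean_zero_def sum.distrib flip: sum_distrib_left)

lemma neumann_laplacian_mean_zero: "L f \<in> mean_zero"
  by (simp add: mean_zero_def sum_neumann_laplacian neumann_laplacian_outside)

lemma graph_dist_le_interior_diameter:
  assumes "x \<in> \<Omega>" "y \<in> \<Omega>"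
  shows "graph_dist G x y \<le> interior_diameter G B"
  unfolding interior_diameter_def using assms by (intro Max_ge) auto

lemma interior_diameter_pos:
  assumes "graph_connected G" "card \<Omega> \<ge> 2"
  shows "interior_diameter G B > 0"
proof -
  obtain x y where xy: "x \<in> \<Omega>" "y \<in> \<Omega>" "x \<noteq> y"
    using card_le_Suc0_iff_eq[OF finite_interior] assms(2) by (metis not_less_eq_eq numeral_2_eq_2)
  then obtain n where "(x, y) \<in> parcs G ^^ n"
    using assms(1) interior_in_verts unfolding connected_iff_relpow by blast
  then have "(x, y) \<in> parcs G ^^ graph_dist G x y"
    using xy interior_in_verts relpow_graph_dist by blast
  then have "graph_dist G x y \<noteq> 0" using xy by (metis relpow_0_E)
  then show ?thesis using graph_dist_le_interior_diameter xy by fastforce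
qed

text \<open>
  The remaining values average to \<open>- f x / (k - 1)\<close>, so one of them is at least that far on the
  other side of zero. Multiplying by \<open>f x\<close> covers both signs of \<open>f x\<close> at once.
\<close>

lemma exists_opposite_value:
  assumes f: "f \<in> mean_zero" and x: "x \<in> \<Omega>" and k: "card \<Omega> \<ge> 2"
  shows "\<exists>y\<in>\<Omega>. f x * f y \<le> - (f x)\<^sup>2 / (real (card \<Omega>) - 1)"
proof (rule ccontr)
  assume "\<not> ?thesis"
  then have less: "- (f x)\<^sup>2 / (real (card \<Omega>) - 1) < f x * f y" if "y \<in> \<Omega> - {x}" for y
    using that by force
  have card: "real (card (\<Omega> - {x})) = real (card \<Omega>) - 1" using x k by simp
  have "\<Omega> - {x} \<noteq> {}"
  proof
    assume "\<Omega> - {x} = {}"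
    then have "card (\<Omega> - {x}) = 0" by (metis card.empty)
    then show False using card k by linarith
  qed
  then have "(\<Sum>y\<in>\<Omega> - {x}. - (f x)\<^sup>2 / (real (card \<Omega>) - 1)) < (\<Sum>y\<in>\<Omega> - {x}. f x * f y)"
    using less by (intro sum_strict_mono) auto
  also have "(\<Sum>y\<in>\<Omega> - {x}. f x * f y) = - (f x)\<^sup>2"
  proof -
    have "f x + (\<Sum>y\<in>\<Omega> - {x}. f y) = 0"
      using f x by (simp add: mean_zero_def sum.remove)
    then have "(\<Sum>y\<in>\<Omega> - {x}. f y) = - f x" by simp
    then show ?thesis by (simp add: power2_eq_square flip: sum_distrib_left)
  qed
  also have "(\<Sum>y\<in>\<Omega> - {x}. - (f x)\<^sup>2 / (real (card \<Omega>) - 1)) = - (f x)\<^sup>2"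
    using k card by simp
  finally show False by simp
qed

text \<open>
  The value of largest modulus and a value opposite to it differ by at least the factor
  \<open>k / (k - 1)\<close> times the former, and this difference is paid for by the energy along a shortest
  walk. The square of the factor together with \<open>\<Sum>\<^sub>\<Omega> f\<^sup>2 \<le> k (f x)\<^sup>2\<close> gives the constant.
\<close>

lemma poincare_inequality:
  assumes conn: "graph_connected G" and k: "card \<Omega> \<ge> 2" and f: "f \<in> mean_zero"
  shows "real (card \<Omega>) / ((real (card \<Omega>) - 1)\<^sup>2 * real (interior_diameter G B)) * (\<Sum>x\<in>\<Omega>. (f x)\<^sup>2)
           \<le> dirichlet_form f f"
proof -
  let ?k = "real (card \<Omega>)" and ?d = "real (interior_diameter G B)"
  have k1: "?k - 1 > 0" using k by simp
  have "\<Omega> \<noteq> {}" using k by auto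
  then obtain x where x: "x \<in> \<Omega>" and max: "\<And>z. z \<in> \<Omega> \<Longrightarrow> \<bar>f z\<bar> \<le> \<bar>f x\<bar>"
  proof -
    have "Max ((\<lambda>z. \<bar>f z\<bar>) ` \<Omega>) \<in> (\<lambda>z. \<bar>f z\<bar>) ` \<Omega>"
      using \<open>\<Omega> \<noteq> {}\<close> by (intro Max_in) auto
    then obtain x where "x \<in> \<Omega>" "Max ((\<lambda>z. \<bar>f z\<bar>) ` \<Omega>) = \<bar>f x\<bar>" by auto
    then show thesis by (metis that Max_ge finite_imageI finite_interior imageI)
  qed
  obtain y where y: "y \<in> \<Omega>" and opp: "f x * f y \<le> - (f x)\<^sup>2 / (?k - 1)"
    using exists_opposite_value[OF f x k] by blast
  have "\<bar>f x\<bar> * (?k / (?k - 1)) \<le> \<bar>f x - f y\<bar>"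
  proof (cases "f x = 0")
    case False
    have "\<bar>f x\<bar> * (\<bar>f x\<bar> * (?k / (?k - 1))) = (f x)\<^sup>2 + (f x)\<^sup>2 / (?k - 1)"
      using k1 by (simp add: field_simps power2_eq_square)
    also have "\<dots> \<le> f x * (f x - f y)"
      using opp by (simp add: algebra_simps power2_eq_square)
    also have "\<dots> \<le> \<bar>f x\<bar> * \<bar>f x - f y\<bar>"
      by (metis abs_ge_self abs_mult)
    finally show ?thesis by (rule mult_left_le_imp_le) (use False in simp)
  qed simp
  then have "(\<bar>f x\<bar> * (?k / (?k - 1)))\<^sup>2 \<le> \<bar>f x - f y\<bar>\<^sup>2"
    using k1 by (intro power_mono) auto
  then have gap: "(?k / (?k - 1))\<^sup>2 * (f x)\<^sup>2 \<le> (f x - f y)\<^sup>2"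
    unfolding power_mult_distrib power2_abs by (simp only: mult.commute)
  obtain n where "(x, y) \<in> parcs G ^^ n"
    using conn x y interior_in_verts unfolding connected_iff_relpow by blast
  then have "(f x - f y)\<^sup>2 \<le> real (graph_dist G x y) * dirichlet_form f f"
    using square_diff_le_dist_energy[of x y n "ext f"] x y
    by (simp add: interior_in_verts ext_interior dirichlet_form_self)
  also have "\<dots> \<le> ?d * dirichlet_form f f"
    using graph_dist_le_interior_diameter[OF x y] dirichlet_form_nonneg
    by (intro mult_right_mono) auto
  finally have energy: "(f x - f y)\<^sup>2 \<le> ?d * dirichlet_form f f" .
  have "(\<Sum>z\<in>\<Omega>. (f z)\<^sup>2) \<le> ?k * (f x)\<^sup>2"
    using max by (intro sum_bounded_above) (simp add: abs_le_square_iff)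
  then have "?k / (?k - 1)\<^sup>2 * (\<Sum>z\<in>\<Omega>. (f z)\<^sup>2) \<le> ?k / (?k - 1)\<^sup>2 * (?k * (f x)\<^sup>2)"
    by (intro mult_left_mono) auto
  also have "\<dots> = (?k / (?k - 1))\<^sup>2 * (f x)\<^sup>2"
    by (simp add: power2_eq_square power_divide)
  also have "\<dots> \<le> ?d * dirichlet_form f f"
    using gap energy by simp
  finally have "?k / (?k - 1)\<^sup>2 * (\<Sum>z\<in>\<Omega>. (f z)\<^sup>2) \<le> ?d * dirichlet_form f f" .
  then have "?k / (?k - 1)\<^sup>2 * (\<Sum>z\<in>\<Omega>. (f z)\<^sup>2) / ?d \<le> dirichlet_form f f"
    using interior_diameter_pos[OF conn k] by (simp only: pos_divide_le_eq of_nat_0_less_iff mult.commute)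
  then show ?thesis by (simp only: times_divide_eq_left divide_divide_eq_left)
qed

lemma poincare_constant_pos:
  assumes "graph_connected G" "card \<Omega> \<ge> 2"
  shows "real (card \<Omega>) / ((real (card \<Omega>) - 1)\<^sup>2 * real (interior_diameter G B)) > 0"
proof -
  have "real (card \<Omega>) - 1 > 0" using assms(2) by simp
  then show ?thesis
    using interior_diameter_pos[OF assms] assms(2)
    by (intro divide_pos_pos mult_pos_pos zero_less_power) simp_all
qed

section \<open>Eigenvalues of the Neumann Laplacian\<close>

lemma eigenspaceI:
  assumes "\<And>x. x \<notin> \<Omega> \<Longrightarrow> f x = 0" "\<And>x. L f x = l * f x"
  shows "f \<in> neumann_eigenspace G B l"
  using assms by (auto simp: neumann_eigenspace_def)

lemma eigenspaceD:
  assumes "f \<in> neumann_eigenspace G B l"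
  shows "x \<notin> \<Omega> \<Longrightarrow> f x = 0" "L f x = l * f x"
  using assms by (auto simp: neumann_eigenspace_def fun_eq_iff)

lemma eigenspace_form:
  assumes "f \<in> neumann_eigenspace G B l"
  shows "dirichlet_form f h = l * (\<Sum>x\<in>\<Omega>. f x * h x)"
  by (simp flip: green_formula add: eigenspaceD(2)[OF assms] sum_distrib_left mult.assoc)

lemma eigenspace_orthogonal:
  assumes f: "f \<in> neumann_eigenspace G B l" and h: "h \<in> neumann_eigenspace G B m" and "l \<noteq> m"
  shows "(\<Sum>x\<in>\<Omega>. f x * h x) = 0"
proof -
  have "l * (\<Sum>x\<in>\<Omega>. f x * h x) = m * (\<Sum>x\<in>\<Omega>. h x * f x)"
    using dirichlet_form_commute[of f h] eigenspace_form[OF f] eigenspace_form[OF h] by simp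
  also have "(\<Sum>x\<in>\<Omega>. h x * f x) = (\<Sum>x\<in>\<Omega>. f x * h x)" by (simp add: mult.commute)
  finally show ?thesis using \<open>l \<noteq> m\<close> by simp
qed

lemma eigenspace_mean_zero:
  assumes f: "f \<in> neumann_eigenspace G B l" and "l \<noteq> 0"
  shows "f \<in> mean_zero"
proof -
  have "l * (\<Sum>x\<in>\<Omega>. f x) = (\<Sum>x\<in>\<Omega>. L f x)"
    by (simp add: eigenspaceD(2)[OF f] sum_distrib_left)
  then show ?thesis
    using sum_neumann_laplacian \<open>l \<noteq> 0\<close> eigenspaceD(1)[OF f] by (simp add: mean_zero_def)
qed

lemma sum_squares_pos:
  assumes "\<And>x. x \<notin> \<Omega> \<Longrightarrow> f x = 0" "f \<noteq> (\<lambda>x. 0)"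
  shows "(\<Sum>x\<in>\<Omega>. (f x)\<^sup>2) > (0::real)"
proof -
  obtain a where a: "f a \<noteq> 0" using assms(2) by auto
  then have "a \<in> \<Omega>" using assms(1) by blast
  then show ?thesis using a by (intro sum_pos2[of _ a]) auto
qed

lemma fun_sum_apply:
  fixes f :: "'b \<Rightarrow> 'c \<Rightarrow> 'd::comm_monoid_add"
  shows "(\<Sum>i\<in>I. f i) x = (\<Sum>i\<in>I. f i x)"
  by (induction I rule: infinite_finite_induct) simp_all

text \<open>
  Pairing a vanishing linear combination with one of its members isolates that coefficient.
\<close>

lemma independent_if_orthogonal:
  assumes supp: "\<And>f x. f \<in> S \<Longrightarrow> x \<notin> \<Omega> \<Longrightarrow> f x = 0"
    and nz: "\<And>f. f \<in> S \<Longrightarrow> f \<noteq> (\<lambda>x. 0)"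
    and orth: "\<And>f h. f \<in> S \<Longrightarrow> h \<in> S \<Longrightarrow> f \<noteq> h \<Longrightarrow> (\<Sum>x\<in>\<Omega>. f x * h x) = 0"
  shows "real_fun.independent S"
  unfolding real_fun.independent_explicit_finite_subsets
proof (intro allI impI ballI)
  fix T u h
  assume T: "T \<subseteq> S" "finite T" and zero: "(\<Sum>v\<in>T. (\<lambda>x. u v * v x)) = 0" and h: "h \<in> T"
  have zero': "(\<Sum>v\<in>T. u v * v x) = 0" for x
    using fun_cong[OF zero, of x] by (simp add: fun_sum_apply)
  have "0 = (\<Sum>x\<in>\<Omega>. (\<Sum>v\<in>T. u v * v x) * h x)" by (simp add: zero')
  also have "\<dots> = (\<Sum>v\<in>T. u v * (\<Sum>x\<in>\<Omega>. v x * h x))"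
    unfolding sum_distrib_right sum_distrib_left by (subst sum.swap) (simp add: mult.assoc)
  also have "\<dots> = (\<Sum>v\<in>T. if v = h then u h * (\<Sum>x\<in>\<Omega>. (h x)\<^sup>2) else 0)"
    using T h orth by (intro sum.cong) (auto simp: power2_eq_square subset_iff)
  also have "\<dots> = u h * (\<Sum>x\<in>\<Omega>. (h x)\<^sup>2)" using T h by simp
  finally show "u h = 0"
    using sum_squares_pos[of h] supp[of h] nz[of h] T h by (auto simp: subset_iff)
qed

text \<open>
  The ambient space of all functions on the vertex type may be infinite-dimensional, so finiteness
  is expressed by a finite set that spans the functions supported in the interior.
\<close>

lemma supported_in_finite_span:
  "\<exists>U. finite U \<and> (\<forall>f. (\<forall>x. x \<notin> \<Omega> \<longrightarrow> f x = 0) \<longrightarrow> f \<in> real_fun.span U)"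
proof (intro exI conjI allI impI)
  let ?e = "\<lambda>a. indicator {a} :: 'a \<Rightarrow> real"
  show "finite (?e ` \<Omega>)" by simp
  fix f :: "'a \<Rightarrow> real" assume f: "\<forall>x. x \<notin> \<Omega> \<longrightarrow> f x = 0"
  have "f = (\<Sum>a\<in>\<Omega>. (\<lambda>x. f a * ?e a x))"
  proof (rule HOL.ext)
    fix x
    have "(\<Sum>a\<in>\<Omega>. f a * ?e a x) = (\<Sum>a\<in>\<Omega>. if a = x then f x else 0)"
      by (intro sum.cong) auto
    then show "f x = (\<Sum>a\<in>\<Omega>. (\<lambda>x. f a * ?e a x)) x"
      using f by (simp add: fun_sum_apply)
  qed
  also have "\<dots> \<in> real_fun.span (?e ` \<Omega>)"
    by (intro real_fun.span_sum real_fun.span_scale real_fun.span_base) auto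
  finally show "f \<in> real_fun.span (?e ` \<Omega>)" .
qed

text \<open>
  In an infinite-dimensional space the dimension function also returns zero on subspaces
  without a finite basis; the finite spanning set excludes this case.
\<close>

lemma dim_eigenspace_eq_0_iff:
  "real_fun.dim (neumann_eigenspace G B l) = 0 \<longleftrightarrow> neumann_eigenspace G B l \<subseteq> {\<lambda>x. 0}"
proof -
  obtain U where U: "finite U" "\<And>f. (\<forall>x. x \<notin> \<Omega> \<longrightarrow> f x = 0) \<Longrightarrow> f \<in> real_fun.span U"
    using supported_in_finite_span by blast
  obtain S where S: "S \<subseteq> neumann_eigenspace G B l" "real_fun.independent S"
      "neumann_eigenspace G B l \<subseteq> real_fun.span S"
      "card S = real_fun.dim (neumann_eigenspace G B l)"
    by (rule real_fun.basis_exists)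
  have "S \<subseteq> real_fun.span U" using S(1) U(2) by (auto simp: neumann_eigenspace_def)
  then have "finite S" using real_fun.independent_span_bound[OF U(1) S(2)] by blast
  then have "real_fun.dim (neumann_eigenspace G B l) = 0 \<longleftrightarrow> S = {}"
    using S(4) by auto
  also have "\<dots> \<longleftrightarrow> neumann_eigenspace G B l \<subseteq> {\<lambda>x. 0}"
  proof
    assume "S = {}"
    then show "neumann_eigenspace G B l \<subseteq> {\<lambda>x. 0}" using S(3) by (simp add: zero_fun_def)
  next
    assume "neumann_eigenspace G B l \<subseteq> {\<lambda>x. 0}"
    then show "S = {}"
      using S(1) real_fun.dependent_zero[of S] S(2) unfolding zero_fun_def by blast
  qed
  finally show ?thesis .
qed

text \<open>
  One eigenfunction for each eigenvalue yields an orthogonal, hence independent family in a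
  space with a finite spanning set.
\<close>

lemma finite_eigenvalues: "finite {l. real_fun.dim (neumann_eigenspace G B l) \<noteq> 0}"
proof -
  define ev where "ev = {l. real_fun.dim (neumann_eigenspace G B l) \<noteq> 0}"
  obtain U where U: "finite U" "\<And>f. (\<forall>x. x \<notin> \<Omega> \<longrightarrow> f x = 0) \<Longrightarrow> f \<in> real_fun.span U"
    using supported_in_finite_span by blast
  have "\<exists>f. f \<in> neumann_eigenspace G B l \<and> f \<noteq> (\<lambda>x. 0)" if "l \<in> ev" for l
    using that dim_eigenspace_eq_0_iff by (auto simp: ev_def)
  then obtain v where "\<forall>l\<in>ev. v l \<in> neumann_eigenspace G B l \<and> v l \<noteq> (\<lambda>x. 0)"
    using bchoice[of ev "\<lambda>l f. f \<in> neumann_eigenspace G B l \<and> f \<noteq> (\<lambda>x. 0)"] by blast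
  then have v: "v l \<in> neumann_eigenspace G B l" "v l \<noteq> (\<lambda>x. 0)" if "l \<in> ev" for l
    using that by blast+
  have inj: "inj_on v ev"
  proof (rule inj_onI, rule ccontr)
    fix l m assume lm: "l \<in> ev" "m \<in> ev" "v l = v m" "l \<noteq> m"
    then have "(\<Sum>x\<in>\<Omega>. (v l x)\<^sup>2) = 0"
      using eigenspace_orthogonal[OF v(1)[of l] v(1)[of m]] by (simp add: power2_eq_square)
    then show False
      using sum_squares_pos[OF eigenspaceD(1)[OF v(1)] v(2), of l] lm(1) by simp
  qed
  have "(\<Sum>x\<in>\<Omega>. v l x * v m x) = 0" if "l \<in> ev" "m \<in> ev" "v l \<noteq> v m" for l m
    using that by (intro eigenspace_orthogonal[OF v(1) v(1)]) auto
  then have "real_fun.independent (v ` ev)"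
    using v(2) eigenspaceD(1)[OF v(1)]
    by (intro independent_if_orthogonal) auto
  moreover have "v ` ev \<subseteq> real_fun.span U"
    using U(2) eigenspaceD(1)[OF v(1)] by blast
  ultimately have "finite (v ` ev)"
    using real_fun.independent_span_bound[OF U(1)] by blast
  then show ?thesis using inj unfolding ev_def by (rule finite_imageD)
qed

lemma neumann_eigenvalues_list:
  "sorted (neumann_eigenvalues G B)"
  "count_list (neumann_eigenvalues G B) l = real_fun.dim (neumann_eigenspace G B l)"
  using theI'[OF ex1_sorted_count_list[OF finite_eigenvalues]]
  unfolding neumann_eigenvalues_def by blast+

lemma mem_neumann_eigenvalues_iff:
  "l \<in> set (neumann_eigenvalues G B) \<longleftrightarrow> (\<exists>f\<in>neumann_eigenspace G B l. f \<noteq> (\<lambda>x. 0))"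
proof -
  have "l \<in> set (neumann_eigenvalues G B) \<longleftrightarrow> count_list (neumann_eigenvalues G B) l \<noteq> 0"
    by (simp add: count_list_0_iff)
  then show ?thesis unfolding neumann_eigenvalues_list(2) dim_eigenspace_eq_0_iff by auto
qed

lemma neumann_eigenvalue_nonneg:
  assumes "l \<in> set (neumann_eigenvalues G B)"
  shows "l \<ge> 0"
proof -
  obtain f where f: "f \<in> neumann_eigenspace G B l" "f \<noteq> (\<lambda>x. 0)"
    using assms mem_neumann_eigenvalues_iff by blast
  then have "0 \<le> l * (\<Sum>x\<in>\<Omega>. (f x)\<^sup>2)" "(\<Sum>x\<in>\<Omega>. (f x)\<^sup>2) > 0"
    using dirichlet_form_nonneg[of f] eigenspace_form[OF f(1), of f]
      sum_squares_pos eigenspaceD(1)[OF f(1)] by (auto simp: power2_eq_square)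
  then show ?thesis by (simp add: zero_le_mult_iff)
qed

text \<open>
  Subtracting the mean from a function in the kernel leaves a function of sum zero without energy,
  which vanishes by the Poincare inequality.
\<close>

lemma dim_kernel:
  assumes conn: "graph_connected G" and k: "card \<Omega> \<ge> 2"
  shows "real_fun.dim (neumann_eigenspace G B 0) = 1"
proof -
  let ?one = "indicator \<Omega> :: 'a \<Rightarrow> real"
  have one: "?one \<in> neumann_eigenspace G B 0"
    by (rule eigenspaceI) (auto simp: neumann_laplacian_one)
  have "neumann_eigenspace G B 0 \<subseteq> real_fun.span {?one}"
  proof
    fix f assume f: "f \<in> neumann_eigenspace G B 0"
    define c where "c = (\<Sum>x\<in>\<Omega>. f x) / real (card \<Omega>)"
    define h where "h = (\<lambda>x. f x + - c * ?one x)"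
    have supp: "h x = 0" if "x \<notin> \<Omega>" for x
      using that eigenspaceD(1)[OF f] by (simp add: h_def)
    have "(\<Sum>x\<in>\<Omega>. h x) = 0"
      using k by (simp add: h_def c_def sum.distrib sum_subtractf)
    then have "h \<in> mean_zero" using supp by (simp add: mean_zero_def)
    moreover have "L h = (\<lambda>x. 0)"
      unfolding h_def neumann_laplacian_linear
      by (simp add: neumann_laplacian_one eigenspaceD(2)[OF f])
    then have "dirichlet_form h h = 0" by (simp flip: green_formula)
    ultimately have "\<not> (\<Sum>x\<in>\<Omega>. (h x)\<^sup>2) > 0"
      using poincare_inequality[OF conn k] poincare_constant_pos[OF conn k]
      by (metis mult_pos_pos not_le)
    then have "h = (\<lambda>x. 0)" using sum_squares_pos supp by blast
    then have "f = (\<lambda>x. c * ?one x)" by (auto simp: h_def fun_eq_iff)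
    then show "f \<in> real_fun.span {?one}" by (simp add: real_fun.span_scale real_fun.span_base)
  qed
  moreover have "?one \<noteq> 0"
  proof -
    have "\<Omega> \<noteq> {}" using k by auto
    then obtain x where "x \<in> \<Omega>" by blast
    then have "?one x \<noteq> 0" by simp
    then show ?thesis by (metis zero_fun_apply)
  qed
  ultimately show ?thesis
    using one by (intro real_fun.dim_unique[of "{?one}"]) auto
qed

section \<open>The variational characterisation of the second eigenvalue\<close>

text \<open>
  The unit sphere of the functions of sum zero is compact in the product topology: it is a closed
  subset of a box whose sides are \<open>[-1, 1]\<close> at interior vertices and a single point elsewhere. The
  Dirichlet form is continuous, and its minimum on the sphere scales to all functions of sum zero.
\<close>

lemma rayleigh_minimiser_exists:
  assumes h0: "h0 \<in> mean_zero" "h0 \<noteq> (\<lambda>x. 0)"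
  obtains f where "f \<in> mean_zero" "(\<Sum>x\<in>\<Omega>. (f x)\<^sup>2) = 1"
    "\<And>h. h \<in> mean_zero \<Longrightarrow> dirichlet_form f f * (\<Sum>x\<in>\<Omega>. (h x)\<^sup>2) \<le> dirichlet_form h h"
proof -
  define K where "K = {f \<in> mean_zero. (\<Sum>x\<in>\<Omega>. (f x)\<^sup>2) = 1}"
  note coord [continuous_intros] = continuous_on_product_coordinates
  have scale: "(\<lambda>x. 1 / sqrt (\<Sum>x\<in>\<Omega>. (h x)\<^sup>2) * h x) \<in> K"
    if "h \<in> mean_zero" "(\<Sum>x\<in>\<Omega>. (h x)\<^sup>2) > 0" for h
    using that by (simp add: K_def mean_zero_def power_divide flip: sum_divide_distrib)
  let ?box = "PiE UNIV (\<lambda>x. if x \<in> \<Omega> then {-1..1::real} else {0})"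
  have "compactin (product_topology (\<lambda>x. euclidean) UNIV) ?box"
    by (subst compactin_PiE) (auto simp: compactin_euclidean_iff)
  then have "compact ?box"
    by (simp add: euclidean_product_topology compactin_euclidean_iff)
  moreover have "closed K"
  proof -
    have "K = (\<Inter>x\<in>-\<Omega>. {f. f x = 0}) \<inter> {f. (\<Sum>x\<in>\<Omega>. f x) = 0} \<inter> {f. (\<Sum>x\<in>\<Omega>. (f x)\<^sup>2) = 1}"
      by (auto simp: K_def mean_zero_def)
    also have "closed \<dots>"
      by (intro closed_Int closed_INT ballI closed_Collect_eq continuous_intros)
    finally show ?thesis .
  qed
  moreover have "K \<subseteq> ?box"
  proof
    fix f assume f: "f \<in> K"
    have "\<bar>f x\<bar> \<le> 1" if "x \<in> \<Omega>" for x
    proof -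
      have "(f x)\<^sup>2 \<le> (\<Sum>x\<in>\<Omega>. (f x)\<^sup>2)" using that by (intro member_le_sum) auto
      then show ?thesis using f by (simp add: K_def abs_square_le_1)
    qed
    then show "f \<in> ?box" using f by (auto simp: K_def mean_zero_def abs_le_iff)
  qed
  ultimately have "compact K" by (metis compact_Int_closed inf.absorb_iff2)
  moreover have "K \<noteq> {}"
    using scale[OF h0(1)] sum_squares_pos[OF _ h0(2)] h0(1) by (auto simp: mean_zero_def)
  moreover have "continuous_on K (\<lambda>f. dirichlet_form f f)"
  proof -
    have "continuous_on UNIV (\<lambda>f. ext f x)" for x
      unfolding neumann_extension_def
      by (cases "x \<in> \<Omega>"; cases "x \<in> B"; simp only: if_True if_False)
        (intro continuous_on_mult continuous_on_sum continuous_on_const coord)+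
    then have "continuous_on UNIV (\<lambda>f. dirichlet_form f f)"
      unfolding dirichlet_form_self case_prod_unfold by (intro continuous_intros) auto
    then show ?thesis by (rule continuous_on_subset) simp
  qed
  ultimately obtain f where f: "f \<in> K" "\<And>h. h \<in> K \<Longrightarrow> dirichlet_form f f \<le> dirichlet_form h h"
    using continuous_attains_inf[of K "\<lambda>f. dirichlet_form f f"] by blast
  show thesis
  proof (rule that[of f])
    fix h assume h: "h \<in> mean_zero"
    let ?s = "\<Sum>x\<in>\<Omega>. (h x)\<^sup>2"
    show "dirichlet_form f f * ?s \<le> dirichlet_form h h"
    proof (cases "?s > 0")
      case True
      have "dirichlet_form f f \<le> (1 / sqrt ?s)\<^sup>2 * dirichlet_form h h"
        using f(2)[OF scale[OF h True]] by (simp only: dirichlet_form_scaled)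
      then show ?thesis using True by (simp add: power_divide field_simps)
    next
      case False
      then have "?s = 0" by (intro antisym sum_nonneg) auto
      then show ?thesis using dirichlet_form_nonneg by simp
    qed
  qed (use f(1) in \<open>auto simp: K_def\<close>)
qed

text \<open>
  First variation in the direction of the residual \<open>g = L f - m f\<close>, which is itself an admissible
  direction. Along \<open>f + t g\<close> the excess of the energy over \<open>m\<close> times the square sum is a non-negative
  quadratic in \<open>t\<close> without constant term, so its linear coefficient \<open>2 \<Sum>\<^sub>\<Omega> g\<^sup>2\<close> vanishes.
\<close>

lemma rayleigh_minimiser_eigenfunction:
  assumes f: "f \<in> mean_zero" "(\<Sum>x\<in>\<Omega>. (f x)\<^sup>2) = 1"
    and min: "\<And>h. h \<in> mean_zero \<Longrightarrow> m * (\<Sum>x\<in>\<Omega>. (h x)\<^sup>2) \<le> dirichlet_form h h"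
    and m: "m = dirichlet_form f f"
  shows "f \<in> neumann_eigenspace G B m"
proof -
  define g where "g = (\<lambda>x. L f x + - m * f x)"
  have g: "g \<in> mean_zero"
    unfolding g_def using mean_zero_linear[OF neumann_laplacian_mean_zero f(1)] .
  define s where "s = (\<Sum>x\<in>\<Omega>. (g x)\<^sup>2)"
  define c where "c = dirichlet_form g g - m * (\<Sum>x\<in>\<Omega>. (g x)\<^sup>2)"
  have c: "c \<ge> 0" using min[OF g] by (simp add: c_def)
  have s: "s = dirichlet_form f g - m * (\<Sum>x\<in>\<Omega>. f x * g x)"
  proof -
    have "s = (\<Sum>x\<in>\<Omega>. (L f x + - m * f x) * g x)"
      by (simp add: s_def power2_eq_square g_def)
    then show ?thesis
      by (simp add: algebra_simps sum_subtractf flip: green_formula)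
        (simp add: sum_distrib_left)
  qed
  have var: "0 \<le> 2 * t * s + t\<^sup>2 * c" for t
  proof -
    have "m * (\<Sum>x\<in>\<Omega>. (f x + t * g x)\<^sup>2) \<le> dirichlet_form f f + 2 * t * dirichlet_form f g + t\<^sup>2 * dirichlet_form g g"
      using min[OF mean_zero_linear[OF f(1) g, of t]] by (simp add: dirichlet_form_add_scaled)
    moreover have "(\<Sum>x\<in>\<Omega>. (f x + t * g x)\<^sup>2)
        = 1 + 2 * t * (\<Sum>x\<in>\<Omega>. f x * g x) + t\<^sup>2 * (\<Sum>x\<in>\<Omega>. (g x)\<^sup>2)"
      by (simp add: f(2)[symmetric] power2_sum power_mult_distrib sum.distrib sum_distrib_left algebra_simps)
    ultimately show ?thesis
      by (simp add: s c_def m algebra_simps)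
  qed
  have "s \<ge> 0" by (simp add: s_def sum_nonneg)
  have "s = 0"
  proof (rule ccontr)
    assume "s \<noteq> 0"
    \<comment> \<open>The parabola has its minimum at \<open>- s / c\<close>; the shift by one allows for \<open>c = 0\<close>.\<close>
    define r where "r = s / (c + 1)"
    have sr: "s = r * (c + 1)" using c by (simp add: r_def)
    have "2 * (- r) * s + (- r)\<^sup>2 * c = - (r\<^sup>2 * (c + 2))"
      by (simp add: sr power2_eq_square algebra_simps)
    also have "\<dots> < 0"
      using c \<open>s \<noteq> 0\<close> sr by simp
    finally show False using var[of "- r"] by simp
  qed
  then have "g = (\<lambda>x. 0)"
    using sum_squares_pos[of g] g by (force simp: s_def mean_zero_def)
  then have "L f x = m * f x" for x
    by (auto simp: g_def fun_eq_iff)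
  then show ?thesis using f(1) by (intro eigenspaceI) (auto simp: mean_zero_def)
qed

lemma exists_mean_zero_nonzero:
  assumes "card \<Omega> \<ge> 2"
  shows "\<exists>h\<in>mean_zero. h \<noteq> (\<lambda>x. 0)"
proof -
  obtain x y where xy: "x \<in> \<Omega>" "y \<in> \<Omega>" "x \<noteq> y"
    using card_le_Suc0_iff_eq[OF finite_interior] assms by (metis not_less_eq_eq numeral_2_eq_2)
  then have "(\<lambda>z. indicator {x} z - indicator {y} z) \<in> mean_zero"
    by (auto simp: mean_zero_def sum_subtractf indicator_def sum.delta' cong: if_cong)
  moreover have "(\<lambda>z. indicator {x} z - indicator {y} z) \<noteq> (\<lambda>z. 0::real)"
    using xy(3) by (auto simp: fun_eq_iff indicator_def)
  ultimately show ?thesis by blast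
qed

text \<open>
  Zero occurs exactly once in the list and all other entries are positive, with eigenfunctions of
  sum zero. The minimum of the Rayleigh quotient occurs at a later position than zero, hence is
  at least the second entry.
\<close>

lemma second_eigenvalue:
  assumes conn: "graph_connected G" and k: "card \<Omega> \<ge> 2"
  shows "\<exists>f\<in>neumann_eigenspace G B (neumann_eigenvalue G B 2).
           f \<in> mean_zero \<and> f \<noteq> (\<lambda>x. 0)" (is ?eigen)
    and "h \<in> mean_zero \<Longrightarrow>
           neumann_eigenvalue G B 2 * (\<Sum>x\<in>\<Omega>. (h x)\<^sup>2) \<le> dirichlet_form h h"
proof -
  let ?ls = "neumann_eigenvalues G B"
  obtain f where f: "f \<in> mean_zero" "(\<Sum>x\<in>\<Omega>. (f x)\<^sup>2) = 1" and
    min: "\<And>h. h \<in> mean_zero \<Longrightarrow> dirichlet_form f f * (\<Sum>x\<in>\<Omega>. (h x)\<^sup>2) \<le> dirichlet_form h h"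
    using exists_mean_zero_nonzero[OF k] rayleigh_minimiser_exists by metis
  define m where "m = dirichlet_form f f"
  have "f \<in> neumann_eigenspace G B m"
    using rayleigh_minimiser_eigenfunction[OF f _ m_def] min by (simp add: m_def)
  moreover have "f \<noteq> (\<lambda>x. 0)" using f(2) by auto
  ultimately have "m \<in> set ?ls" using mem_neumann_eigenvalues_iff by blast
  then obtain i where i: "i < length ?ls" "?ls ! i = m" by (metis in_set_conv_nth)
  have "m > 0"
    using poincare_inequality[OF conn k f(1)] poincare_constant_pos[OF conn k] f(2)
    by (simp add: m_def)
  have count0: "count_list ?ls 0 = 1"
    using dim_kernel[OF conn k] neumann_eigenvalues_list(2) by simp
  then have "0 \<in> set ?ls" by (metis count_list_0_iff zero_neq_one)
  then obtain j where j: "j < length ?ls" "?ls ! j = 0" by (metis in_set_conv_nth)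
  then have "?ls ! 0 \<le> 0" using neumann_eigenvalues_list(1) by (metis sorted_nth_mono le0)
  moreover have "?ls ! 0 \<ge> 0"
    using j by (intro neumann_eigenvalue_nonneg nth_mem) linarith
  ultimately have first: "?ls ! 0 = 0" by simp
  then have "i \<noteq> 0" using i(2) \<open>m > 0\<close> by (cases "i = 0") simp_all
  then have len: "1 < length ?ls" using i by simp
  have "?ls ! 1 \<noteq> 0"
  proof
    assume "?ls ! 1 = 0"
    moreover obtain a b ms where "?ls = a # b # ms"
      using len by (cases ?ls; cases "tl ?ls") auto
    ultimately have "count_list ?ls 0 \<ge> 2" using first by simp
    then show False using count0 by simp
  qed
  moreover have eig2: "neumann_eigenvalue G B 2 = ?ls ! 1" by (simp add: neumann_eigenvalue_def)
  moreover obtain e where "e \<in> neumann_eigenspace G B (?ls ! 1)" "e \<noteq> (\<lambda>x. 0)"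
    using mem_neumann_eigenvalues_iff nth_mem[OF len] by blast
  ultimately show ?eigen using eigenspace_mean_zero by metis
  assume h: "h \<in> mean_zero"
  have "?ls ! 1 \<le> m"
    using neumann_eigenvalues_list(1) i \<open>i \<noteq> 0\<close> by (metis sorted_nth_mono less_one not_le)
  then have "neumann_eigenvalue G B 2 * (\<Sum>x\<in>\<Omega>. (h x)\<^sup>2) \<le> m * (\<Sum>x\<in>\<Omega>. (h x)\<^sup>2)"
    unfolding eig2 by (intro mult_right_mono) (auto intro: sum_nonneg)
  also have "\<dots> \<le> dirichlet_form h h" using min[OF h] by (simp add: m_def)
  finally show "neumann_eigenvalue G B 2 * (\<Sum>x\<in>\<Omega>. (h x)\<^sup>2) \<le> dirichlet_form h h" .
qed

lemma second_eigenvalue_lower_bound: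
  assumes "graph_connected G" "card \<Omega> \<ge> 2"
  shows "real (card \<Omega>) / ((real (card \<Omega>) - 1)\<^sup>2 * real (interior_diameter G B))
           \<le> neumann_eigenvalue G B 2"
proof -
  obtain f where f: "f \<in> neumann_eigenspace G B (neumann_eigenvalue G B 2)"
      "f \<in> mean_zero" "f \<noteq> (\<lambda>x. 0)"
    using second_eigenvalue(1)[OF assms] by blast
  then have "(\<Sum>x\<in>\<Omega>. (f x)\<^sup>2) > 0" using sum_squares_pos by (auto simp: mean_zero_def)
  moreover have "dirichlet_form f f = neumann_eigenvalue G B 2 * (\<Sum>x\<in>\<Omega>. (f x)\<^sup>2)"
    using eigenspace_form[OF f(1)] by (simp add: power2_eq_square)
  ultimately show ?thesis
    using poincare_inequality[OF assms f(2)] by (metis mult_le_cancel_right not_less_iff_gr_or_eq)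
qed

end

section \<open>Paths attain the order of magnitude of the bound\<close>

definition path_graph :: "nat \<Rightarrow> nat pair_pre_digraph" where
  "path_graph k = \<lparr>pverts = {..<k}, parcs = {(i, j). i < k \<and> j < k \<and> (j = Suc i \<or> i = Suc j)}\<rparr>"

lemma path_graph_with_boundary: "graph_with_boundary (path_graph k) {}"
proof
  show "symmetric (with_proj (path_graph k))"
    by (auto simp: symmetric_def path_graph_def intro!: symI)
  show "finite (parcs (path_graph k))"
    by (rule finite_subset[of _ "{..<k} \<times> {..<k}"]) (auto simp: path_graph_def)
qed (auto simp: path_graph_def vertex_boundary_def interior_verts_def)

lemma path_graph_verts: "pverts (path_graph k) = {..<k}"
  by (simp add: path_graph_def)

lemma path_graph_interior: "interior_verts (path_graph k) {} = {..<k}"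
  by (simp add: interior_verts_def path_graph_def)

lemma path_graph_straight_walk:
  assumes "i + n < k"
  shows "(i, i + n) \<in> parcs (path_graph k) ^^ n" "(i + n, i) \<in> parcs (path_graph k) ^^ n"
proof -
  show "(i, i + n) \<in> parcs (path_graph k) ^^ n"
    unfolding relpow_fun_conv using assms
    by (intro exI[of _ "\<lambda>l. i + l"]) (auto simp: path_graph_def)
  show "(i + n, i) \<in> parcs (path_graph k) ^^ n"
    unfolding relpow_fun_conv using assms
    by (intro exI[of _ "\<lambda>l. i + n - l"]) (auto simp: path_graph_def)
qed

lemma path_graph_short_walk:
  assumes "i < k" "j < k"
  shows "\<exists>n<k. (i, j) \<in> parcs (path_graph k) ^^ n"
proof (cases "i \<le> j")
  case True
  then show ?thesis
    using path_graph_straight_walk(1)[of i "j - i" k] assms by (intro exI[of _ "j - i"]) auto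
next
  case False
  then show ?thesis
    using path_graph_straight_walk(2)[of j "i - j" k] assms by (intro exI[of _ "i - j"]) auto
qed

text \<open>
  Each step raises the position by at most one.
\<close>

lemma path_graph_walk_length: "(i, j) \<in> parcs (path_graph k) ^^ n \<Longrightarrow> j \<le> i + n"
proof (induction n arbitrary: j)
  case (Suc n)
  then obtain l where "l \<le> i + n" "(l, j) \<in> parcs (path_graph k)" by auto
  then show ?case by (auto simp: path_graph_def)
qed simp

lemma path_graph_connected:
  assumes "k > 0"
  shows "graph_connected (path_graph k)"
proof -
  interpret graph_with_boundary "path_graph k" "{}" by (rule path_graph_with_boundary)
  show "graph_connected (path_graph k)"
    unfolding connected_iff_relpow path_graph_verts using assms path_graph_short_walk by fast
qed

lemma path_graph_interior_diameter:
  assumes k: "k > 0"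
  shows "interior_diameter (path_graph k) {} = k - 1"
proof (rule antisym)
  interpret graph_with_boundary "path_graph k" "{}" by (rule path_graph_with_boundary)
  have "graph_dist (path_graph k) i j \<le> k - 1" if ij: "i < k" "j < k" for i j
  proof -
    obtain n where n: "n < k" "(i, j) \<in> parcs (path_graph k) ^^ n"
      using path_graph_short_walk[OF ij] by blast
    then have "graph_dist (path_graph k) i j \<le> n"
      using graph_dist_le ij by (simp add: path_graph_verts)
    then show ?thesis using n by simp
  qed
  moreover have "\<Omega> \<times> \<Omega> \<noteq> {}" using k by (auto simp: path_graph_interior)
  ultimately show "interior_diameter (path_graph k) {} \<le> k - 1"
    unfolding interior_diameter_def
    by (intro Max.boundedI) (auto simp: path_graph_interior)
  have "(0, k - 1) \<in> parcs (path_graph k) ^^ (k - 1)"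
    using path_graph_straight_walk(1)[of 0 "k - 1" k] k by simp
  then have "(0, k - 1) \<in> parcs (path_graph k) ^^ graph_dist (path_graph k) 0 (k - 1)"
    using relpow_graph_dist k by (simp add: path_graph_verts)
  then have "k - 1 \<le> graph_dist (path_graph k) 0 (k - 1)"
    using path_graph_walk_length by fastforce
  also have "\<dots> \<le> interior_diameter (path_graph k) {}"
    using graph_dist_le_interior_diameter[of 0 "k - 1"] k by (simp add: path_graph_interior)
  finally show "k - 1 \<le> interior_diameter (path_graph k) {}" .
qed

lemma sum_centered_squares:
  "12 * (\<Sum>i<k. (real i - c)\<^sup>2)
     = real k * (2 * (real k - 1) * (2 * real k - 1) - 12 * c * (real k - 1) + 12 * c\<^sup>2)"
  by (induction k) (simp_all add: power2_eq_square algebra_simps)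

text \<open>
  The test function is linear and centred, so that every edge contributes exactly 1 to its energy
  while its square sum is cubic in \<open>k\<close>.
\<close>

lemma path_graph_second_eigenvalue_le:
  assumes k: "k \<ge> 2"
  shows "neumann_eigenvalue (path_graph k) {} 2 \<le> 12 / (real k * (real k + 1))"
proof -
  interpret graph_with_boundary "path_graph k" "{}" by (rule path_graph_with_boundary)
  let ?c = "(real k - 1) / 2"
  define h where "h = (\<lambda>i. if i < k then real i - ?c else 0)"
  have sum0: "(\<Sum>i<n. real i) = real n * (real n - 1) / 2" for n
    by (induction n) (simp_all add: field_simps)
  have "(\<Sum>i<k. h i) = (\<Sum>i<k. real i) - real k * ?c"
    by (simp add: h_def sum_subtractf)
  then have "h \<in> mean_zero"
    by (simp add: mean_zero_def path_graph_interior sum0) (simp add: h_def)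
  have "12 * (\<Sum>i<k. (h i)\<^sup>2) = 12 * (\<Sum>i<k. (real i - ?c)\<^sup>2)" by (simp add: h_def)
  also have "\<dots> = real k * (real k - 1) * (real k + 1)"
    unfolding sum_centered_squares by (simp add: power2_eq_square field_simps)
  finally have norm: "(\<Sum>i<k. (h i)\<^sup>2) = real k * (real k - 1) * (real k + 1) / 12" by simp
  have ext: "ext h i = h i" for i
    by (simp add: neumann_extension_def path_graph_interior h_def)
  let ?up = "(\<lambda>i. (i, Suc i)) ` {..<k - 1}" and ?down = "(\<lambda>i. (Suc i, i)) ` {..<k - 1}"
  have arcs: "parcs (path_graph k) = ?up \<union> ?down"
    by (auto simp: path_graph_def image_iff)
  have "(\<Sum>(i, j)\<in>parcs (path_graph k). (h i - h j)\<^sup>2) = (\<Sum>a\<in>parcs (path_graph k). 1)"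
    by (rule sum.cong) (auto simp: path_graph_def h_def)
  also have "\<dots> = real (card ?up + card ?down)"
    unfolding arcs by (subst card_Un_disjoint[symmetric]) auto
  also have "\<dots> = 2 * (real k - 1)"
    using k by (simp add: card_image inj_on_def of_nat_diff)
  finally have form: "dirichlet_form h h = real k - 1"
    by (simp add: dirichlet_form_self ext)
  have "neumann_eigenvalue (path_graph k) {} 2 * (real k * (real k - 1) * (real k + 1) / 12) \<le> real k - 1"
    using second_eigenvalue(2)[OF path_graph_connected _ \<open>h \<in> mean_zero\<close>] k
    by (simp add: path_graph_interior norm form)
  then have "(neumann_eigenvalue (path_graph k) {} 2 * (real k * (real k + 1) / 12)) * (real k - 1) \<le> 1 * (real k - 1)"
    by (simp add: mult_ac)
  moreover have "real k - 1 > 0" using k by simp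
  ultimately have "neumann_eigenvalue (path_graph k) {} 2 * (real k * (real k + 1) / 12) \<le> 1"
    by (rule mult_right_le_imp_le)
  then have "neumann_eigenvalue (path_graph k) {} 2 * (real k * (real k + 1)) \<le> 12" by simp
  moreover have "real k * (real k + 1) > 0" using k by simp
  ultimately show ?thesis by (simp only: pos_le_divide_eq)
qed

section \<open>The eigenvalue bound and its sharpness\<close>

theorem theorem1p1:
  shows "(\<forall>(G :: 'a pair_pre_digraph) B.
            graph_with_boundary G B \<and> graph_connected G \<and> card (interior_verts G B) \<ge> 2 \<longrightarrow>
            (let k = real (card (interior_verts G B)); d = real (interior_diameter G B)
             in neumann_eigenvalue G B 2 \<ge> k / ((k - 1)\<^sup>2 * d))) \<and>
         (\<exists>C::real. C > 0 \<and>
            (\<forall>N::nat. \<exists>(G :: nat pair_pre_digraph) B.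
               graph_with_boundary G B \<and> graph_connected G \<and>
               card (interior_verts G B) \<ge> 2 \<and>
               card (interior_verts G B) \<ge> N \<and> interior_diameter G B \<ge> N \<and>
               (let k = real (card (interior_verts G B)); d = real (interior_diameter G B)
                in neumann_eigenvalue G B 2 \<le> C * (k / ((k - 1)\<^sup>2 * d)))))"
proof (intro conjI allI impI, goal_cases)
  case (1 G B)
  then show ?case
    using graph_with_boundary.second_eigenvalue_lower_bound[of G B] by (simp add: Let_def)
next
  case 2
  show ?case
  proof (intro exI[of _ "12::real"] conjI allI)
    fix N :: nat
    define k where "k = N + 2"
    then have k: "k \<ge> 2" "k - 1 \<ge> N" by simp_all
    have card: "card (interior_verts (path_graph k) {}) = k"
      by (simp add: path_graph_interior)
    have diam: "interior_diameter (path_graph k) {} = k - 1"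
      using k by (intro path_graph_interior_diameter) simp
    have "12 / (real k * (real k + 1)) = 12 * (real k / ((real k)\<^sup>2 * (real k + 1)))"
      using k by (simp add: power2_eq_square)
    also have "\<dots> \<le> 12 * (real k / ((real k - 1)\<^sup>2 * real (k - 1)))"
      using k by (intro mult_left_mono frac_le mult_mono power_mono) (auto simp: of_nat_diff)
    finally have "12 / (real k * (real k + 1)) \<le> 12 * (real k / ((real k - 1)\<^sup>2 * real (k - 1)))" .
    with path_graph_second_eigenvalue_le[OF k(1)]
    have "neumann_eigenvalue (path_graph k) {} 2
        \<le> 12 * (real k / ((real k - 1)\<^sup>2 * real (k - 1)))"
      by (rule order_trans)
    then show "\<exists>(G :: nat pair_pre_digraph) B.
               graph_with_boundary G B \<and> graph_connected G \<and>
               card (interior_verts G B) \<ge> 2 \<and>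
               card (interior_verts G B) \<ge> N \<and> interior_diameter G B \<ge> N \<and>
               (let k = real (card (interior_verts G B)); d = real (interior_diameter G B)
                in neumann_eigenvalue G B 2 \<le> 12 * (k / ((k - 1)\<^sup>2 * d)))"
      using path_graph_with_boundary[of k] path_graph_connected[of k] k
      by (intro exI[of _ "path_graph k"] exI[of _ "{}"]) (simp add: card diam Let_def)
  qed simp
qed

end
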